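(* Let $n\ge 2$, and let $f,g\in\mathbb{C}[z_1,\ldots,z_n]$ be weighted homogeneous polynomials with weights $w_f$ and $w_g$, respectively, such that $w_g=s\,w_f$, where $s$ is a positive rational number. For every sufficiently small $\varepsilon>0$ the following holds. Suppose that $p\in S_\varepsilon\setminus K_{fg}$ is a fold point of the Milnor fibration product map $\Phi:S_\varepsilon\setminus K_{fg}\to T^2$ associated with $f$ and $g$. If $p$ and $i\,\mathrm{grad}\log f(p)$ are linearly dependent over $\mathbb{C}$, then the index of the fold point $p$ is equal to $n-1$.
   Context: Weighted homogeneous: $f\in\mathbb{C}[z_1,\ldots,z_n]$ is weighted homogeneous with weights $w_f=(w_1,\ldots,w_n)$, a sequence of positive rational numbers, if $\sum_{j=1}^n \frac{z_j}{w_j}\frac{\partial f}{\partial z_j}=f$. The equation $w_g=s w_f$ means each weight of $g$ is $s$ times the corresponding weight of $f$. $S_\varepsilon=\{z\in\mathbb{C}^n\mid \|z\|=\varepsilon\}$ and $K_{fg}=\{z\in S_\varepsilon\mid f(z)g(z)=0\}$. The Milnor fibration product map associated with $f,g$ is the $C^\infty$ map $\Phi:S_\varepsilon\setminus K_{fg}\to S^1\times S^1=T^2$, $\Phi(z)=\left(\frac{f(z)}{|f(z)|},\frac{g(z)}{|g(z)|}\right)$. A point $p$ is a singular point of $\Phi$ if $\mathrm{rank}\,d\Phi_p<2$. "For every sufficiently small $\varepsilon>0$" means: there is $\varepsilon_0>0$ (depending on $f,g$) such that the assertion holds for all $0<\varepsilon\le\varepsilon_0$. For holomorphic $h$, $\mathrm{grad}\,h=\left(\overline{\partial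 h/\partial z_1},\ldots,\overline{\partial h/\partial z_n}\right)$; thus $\mathrm{grad}\log f(p)$ has $j$-th entry $\overline{\frac{1}{f(p)}\frac{\partial f}{\partial z_j}(p)}$. Fold point and index: a singular point $p$ of a $C^\infty$ map $\Phi$ from a $(2n-1)$-manifold to a $2$-manifold is a fold point if there are local coordinates $(x_1,\ldots,x_{2n-1})$ centered at $p$ and $(y_1,y_2)$ centered at $\Phi(p)$ in which $y_1\circ\Phi=x_{2n-1}$ and $y_2\circ\Phi=-x_1^2-\cdots-x_\lambda^2+x_{\lambda+1}^2+\cdots+x_{2n-2}^2$ for some $0\le\lambda\le 2n-2$. The number $\lambda$ is the index of the fold point; it is well defined up to replacing $\lambda$ by $2n-2-\lambda$, so the assertion that the index is $n-1$ is unambiguous. *)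

theory Defs
  imports "HOL-Analysis.Analysis" "HOL-Library.Poly_Mapping"
begin

section \<open>Polynomials in $\mathbb{C}[z_1,\ldots,z_n]$\<close>

text \<open>A polynomial is a finitely supported map from exponent vectors to coefficients; the
  variables are indexed by the finite type \<open>'n\<close>, so that $n$ is \<open>CARD('n)\<close>.\<close>

type_synonym 'n cpoly = "('n \<Rightarrow>\<^sub>0 nat) \<Rightarrow>\<^sub>0 complex"

definition poly_eval :: "'n::finite cpoly \<Rightarrow> complex ^ 'n \<Rightarrow> complex" where
  "poly_eval P z =
     (\<Sum>\<alpha>\<in>Poly_Mapping.keys P.
        Poly_Mapping.lookup P \<alpha> * (\<Prod>j\<in>UNIV. (z $ j) ^ Poly_Mapping.lookup \<alpha> j))"

definition cpartial :: "'n::finite \<Rightarrow> (complex ^ 'n \<Rightarrow> complex) \<Rightarrow> complex ^ 'n \<Rightarrow> complex" where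
  "cpartial j h z = deriv (\<lambda>t. h (\<chi> k. if k = j then t else z $ k)) (z $ j)"

text \<open>The Euler equation is stated for polynomial functions, which over the infinite field
  $\mathbb{C}$ is the same as the identity of polynomials.\<close>

definition weighted_homogeneous :: "rat ^ 'n \<Rightarrow> 'n::finite cpoly \<Rightarrow> bool" where
  "weighted_homogeneous w P \<longleftrightarrow>
     (\<forall>j. 0 < w $ j) \<and>
     (\<forall>z. (\<Sum>j\<in>UNIV. z $ j / of_rat (w $ j) * cpartial j (poly_eval P) z) = poly_eval P z)"

definition grad_log :: "(complex ^ 'n \<Rightarrow> complex) \<Rightarrow> complex ^ 'n::finite \<Rightarrow> complex ^ 'n" where
  "grad_log h p = (\<chi> j. cnj (1 / h p * cpartial j h p))"

text \<open>Linear dependence over $\mathbb{C}$ of the family $(u, v)$, so $u = v$ counts as dependent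
  (unlike for the set \<open>{u, v}\<close>).\<close>

definition lin_dependent_pair :: "complex ^ 'n \<Rightarrow> complex ^ 'n::finite \<Rightarrow> bool" where
  "lin_dependent_pair u v \<longleftrightarrow> (\<exists>a b :: complex. (a, b) \<noteq> (0, 0) \<and> a *s u + b *s v = 0)"


section \<open>Smooth maps, local coordinates and fold points\<close>

primrec Ck_on ::
  "nat \<Rightarrow> 'a::real_normed_vector set \<Rightarrow> ('a \<Rightarrow> 'b::real_normed_vector) \<Rightarrow> bool" where
  "Ck_on 0 U f \<longleftrightarrow> continuous_on U f"
| "Ck_on (Suc k) U f \<longleftrightarrow>
     (\<forall>x\<in>U. f differentiable (at x)) \<and> (\<forall>v. Ck_on k U (\<lambda>x. frechet_derivative f (at x) v))"

text \<open>Only meaningful for open \<open>U\<close>.\<close>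

definition smooth_on ::
  "'a::real_normed_vector set \<Rightarrow> ('a \<Rightarrow> 'b::real_normed_vector) \<Rightarrow> bool" where
  "smooth_on U f \<longleftrightarrow> (\<forall>k. Ck_on k U f)"

text \<open>Local coordinates, centered at \<open>p\<close>, of a submanifold \<open>M\<close> of a Euclidean space, with domain
  \<open>U \<inter> M\<close>. Smooth functions on a submanifold are locally restrictions of smooth functions on an
  open set of the ambient space, so up to shrinking the domain these are all the local
  coordinates.\<close>

definition local_coords ::
  "'a::euclidean_space set \<Rightarrow> 'a \<Rightarrow> 'a set \<Rightarrow> ('a \<Rightarrow> 'b::euclidean_space) \<Rightarrow> bool" where
  "local_coords M p U x \<longleftrightarrow>
     open U \<and> p \<in> U \<inter> M \<and> x p = 0 \<and>
     smooth_on U x \<and> open (x ` (U \<inter> M)) \<and>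
     (\<exists>\<psi>. smooth_on (x ` (U \<inter> M)) \<psi> \<and> (\<forall>q \<in> U \<inter> M. \<psi> (x q) = q))"

text \<open>The tangent space, as the set of velocity vectors of smooth curves in \<open>M\<close>.\<close>

definition tangent_space :: "'a::euclidean_space set \<Rightarrow> 'a \<Rightarrow> 'a set" where
  "tangent_space M p =
     {v. \<exists>\<delta> > 0. \<exists>\<gamma> :: real \<Rightarrow> 'a. smooth_on {-\<delta><..<\<delta>} \<gamma> \<and> \<gamma> ` {-\<delta><..<\<delta>} \<subseteq> M \<and> \<gamma> 0 = p \<and>
          (\<gamma> has_vector_derivative v) (at 0)}"

text \<open>The rank at \<open>p\<close> of the restriction to \<open>M\<close> of a map that is differentiable on a
  neighbourhood of \<open>p\<close> in the ambient space; the dimension is over the reals.\<close>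

definition rank_at ::
  "'a::euclidean_space set \<Rightarrow> ('a \<Rightarrow> 'c::euclidean_space) \<Rightarrow> 'a \<Rightarrow> nat" where
  "rank_at M \<Phi> p = dim (frechet_derivative \<Phi> (at p) ` tangent_space M p)"

text \<open>Normal form of a fold of index \<open>l\<close> for a smooth map \<open>\<Phi>\<close> from an $(m+1)$-dimensional
  submanifold \<open>M\<close> to a surface \<open>N\<close>, where $m$ is \<open>CARD('m)\<close>. A coordinate system
  $(x_1,\ldots,x_{m+1})$ on \<open>M\<close> has values in \<open>(real ^ 'm) \<times> real\<close>: the real component is the last
  coordinate, and the components of the vector are the first $m$ coordinates, numbered by \<open>'m\<close>
  instead of $1,\ldots,m$. The set \<open>L\<close> indexes the coordinates that carry a minus sign.\<close>

definition fold_of_index ::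
  "'m::finite itself \<Rightarrow> 'a::euclidean_space set \<Rightarrow> 'c::euclidean_space set \<Rightarrow> ('a \<Rightarrow> 'c) \<Rightarrow> 'a
     \<Rightarrow> nat \<Rightarrow> bool" where
  "fold_of_index TYPE('m) M N \<Phi> p l \<longleftrightarrow>
     rank_at M \<Phi> p < 2 \<and>
     (\<exists>U (x :: 'a \<Rightarrow> (real ^ 'm) \<times> real) V (y :: 'c \<Rightarrow> real \<times> real) (L :: 'm set).
        local_coords M p U x \<and> local_coords N (\<Phi> p) V y \<and>
        \<Phi> ` (U \<inter> M) \<subseteq> V \<inter> N \<and> card L = l \<and>
        (\<forall>q \<in> U \<inter> M.
           fst (y (\<Phi> q)) = snd (x q) \<and>
           snd (y (\<Phi> q)) =
             - (\<Sum>i\<in>L. (fst (x q) $ i)\<^sup>2) + (\<Sum>i\<in>-L. (fst (x q) $ i)\<^sup>2)))"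

definition fold_point ::
  "'m::finite itself \<Rightarrow> 'a::euclidean_space set \<Rightarrow> 'c::euclidean_space set \<Rightarrow> ('a \<Rightarrow> 'c) \<Rightarrow> 'a
     \<Rightarrow> bool" where
  "fold_point TYPE('m) M N \<Phi> p \<longleftrightarrow> (\<exists>l. fold_of_index TYPE('m) M N \<Phi> p l)"


section \<open>The Milnor fibration product map\<close>

definition K_link :: "real \<Rightarrow> 'n::finite cpoly \<Rightarrow> 'n cpoly \<Rightarrow> (complex ^ 'n) set" where
  "K_link \<epsilon> f g = {z \<in> sphere 0 \<epsilon>. poly_eval f z * poly_eval g z = 0}"

definition torus :: "(complex \<times> complex) set" where
  "torus = sphere 0 1 \<times> sphere 0 1"

definition milnor_product :: "'n::finite cpoly \<Rightarrow> 'n cpoly \<Rightarrow> complex ^ 'n \<Rightarrow> complex \<times> complex" where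
  "milnor_product f g z =
     (poly_eval f z / of_real (cmod (poly_eval f z)),
      poly_eval g z / of_real (cmod (poly_eval g z)))"

end

theory Submission
  imports Defs "HOL-Library.Landau_Symbols"
begin

text \<open>Near \<open>p\<close> the two angles of \<open>\<Phi>\<close> are the imaginary parts of the holomorphic functions
  \<open>a = Ln (f / f p)\<close> and \<open>b = Ln (g / g p)\<close>. If \<open>p\<close> and \<open>\<i> grad log f p\<close> are dependent, the Euler
  equation forces \<open>da\<close> to be a real multiple of the hermitian product with \<open>p\<close>. At a fold the
  kernel of \<open>d\<Phi>\<close> has real dimension \<open>2n - 2\<close>, so it is the complex hyperplane orthogonal to \<open>p\<close>; as
  \<open>Im db\<close> vanishes there too, \<open>db\<close> is a multiple of \<open>da\<close>, and the Euler equations give \<open>db = s da\<close>.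
  Hence \<open>b - s a\<close> is holomorphic with a critical point at \<open>p\<close>, and comparing second order terms
  along curves in a fold chart identifies, up to a nonzero factor, the quadratic form of the fold with
  \<open>Im Q\<close> for a complex quadratic form \<open>Q\<close> on the hyperplane. Multiplication by \<open>\<i>\<close> reverses the
  sign of such a form, so its two indices agree.\<close>


section \<open>Quadratic forms and complex hyperplanes\<close>

lemma dim_coordinate_subspace:
  "dim {v :: real ^ 'm::finite. \<forall>i. i \<notin> L \<longrightarrow> v $ i = 0} = card L"
  using dim_substandard_cart[where 'a=real and d=L] by (simp add: dim_vec_eq)

text \<open>The form \<open>q\<close> is negative definite on the coordinate subspace of
  \<open>L\<close>, so it is positive definite on the image of that subspace under \<open>J\<close>.
  The kernel of the projection \<open>P\<close> consists of vectors with \<open>q\<close> at most 0,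
  so \<open>P \<circ> J\<close> is injective on the subspace and dimensions compare.\<close>

lemma card_le_of_reversing_map:
  fixes J :: "real ^ 'm::finite \<Rightarrow> real ^ 'm" and L :: "'m set"
  defines "q \<equiv> \<lambda>v. - (\<Sum>i\<in>L. (v $ i)\<^sup>2) + (\<Sum>i\<in>-L. (v $ i)\<^sup>2)"
  assumes lin: "linear J" and rev: "\<And>v. q (J v) = - q v"
  shows "card L \<le> card (- L)"
proof -
  let ?E = "\<lambda>L. {v :: real ^ 'm. \<forall>i. i \<notin> L \<longrightarrow> v $ i = 0}"
  define P :: "real ^ 'm \<Rightarrow> real ^ 'm" where "P v = (\<chi> i. if i \<in> L then 0 else v $ i)" for v
  have "linear P" by (rule linearI) (auto simp: P_def vec_eq_iff)
  then have PJ: "linear (P \<circ> J)" using lin linear_compose by blast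
  have "subspace (?E L)" by (auto simp: subspace_def)
  have "v = 0" if "v \<in> ?E L" "(P \<circ> J) v = 0" for v
  proof -
    have "J v $ i = 0" if "i \<in> - L" for i
      using \<open>(P \<circ> J) v = 0\<close> that by (auto simp: P_def vec_eq_iff dest: spec[of _ i])
    then have "q (J v) \<le> 0" by (simp add: q_def sum_nonneg)
    moreover have "q v = - (\<Sum>i\<in>L. (v $ i)\<^sup>2)" using \<open>v \<in> ?E L\<close> by (simp add: q_def)
    ultimately have "(\<Sum>i\<in>L. (v $ i)\<^sup>2) = 0"
      using rev[of v] by (intro order_antisym sum_nonneg) auto
    then have "\<forall>i\<in>L. v $ i = 0" by (subst (asm) sum_nonneg_eq_0_iff) auto
    then show ?thesis using \<open>v \<in> ?E L\<close> by (auto simp: vec_eq_iff)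
  qed
  then have "inj_on (P \<circ> J) (?E L)"
    using linear_injective_on_subspace_0[OF PJ \<open>subspace (?E L)\<close>] by blast
  then have "dim (?E L) = dim ((P \<circ> J) ` ?E L)"
    using dim_image_eq[OF PJ, of "?E L"] span_eq_iff[THEN iffD2, OF \<open>subspace (?E L)\<close>] by simp
  also have "\<dots> \<le> dim (?E (- L))"
    by (intro dim_subset) (auto simp: P_def)
  finally show ?thesis by (simp only: dim_coordinate_subspace)
qed

lemma card_eq_of_reversing_map:
  fixes J :: "real ^ 'm::finite \<Rightarrow> real ^ 'm" and L :: "'m set"
  defines "q \<equiv> \<lambda>v. - (\<Sum>i\<in>L. (v $ i)\<^sup>2) + (\<Sum>i\<in>-L. (v $ i)\<^sup>2)"
  assumes lin: "linear J" and rev: "\<And>v. q (J v) = - q v"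
  shows "2 * card L = CARD('m)"
proof -
  have "card L \<le> card (- L)"
    using card_le_of_reversing_map[OF lin] rev unfolding q_def by blast
  \<comment> \<open>Exchanging \<open>L\<close> and its complement replaces \<open>q\<close> by
    \<open>- q\<close>, and \<open>J\<close> reverses the sign of that form as well.\<close>
  moreover have "card (- L) \<le> card (- (- L))"
    using rev unfolding q_def by (intro card_le_of_reversing_map[OF lin]) (simp add: algebra_simps)
  moreover have "card L + card (- L) = CARD('m)"
    using card_Un_disjoint[of L "- L"] by (simp add: Compl_partition)
  ultimately show ?thesis by simp
qed

lemma scaleR_eq_of_real_vector_mult: "r *\<^sub>R (v :: complex ^ 'n) = of_real r *s v"
  unfolding vec_eq_iff vector_scaleR_component vector_smult_component
  by (simp add: scaleR_conv_of_real)

text \<open>Splits complex orthogonality to \<open>w\<close> into real orthogonality to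
  \<open>w\<close> and to \<open>\<i> *s w\<close>, which makes real dimension counts
  available.\<close>

lemma Re_hermitian_product:
  fixes v w :: "complex ^ 'n::finite"
  shows "Re (\<Sum>j\<in>UNIV. v $ j * cnj (w $ j)) = v \<bullet> w"
    and "Im (\<Sum>j\<in>UNIV. v $ j * cnj (w $ j)) = v \<bullet> (\<i> *s w)"
  by (simp_all add: inner_vec_def inner_complex_def algebra_simps)

text \<open>The complex hyperplane orthogonal to \<open>p\<close> is the real orthogonal complement
  of the span of \<open>p\<close> and \<open>\<i> *s p\<close>, so its real dimension is 2n - 2. A
  subspace of at least that dimension inside it exhausts it.\<close>

lemma complex_hyperplane_eq:
  fixes p :: "complex ^ 'n::finite" and S :: "(complex ^ 'n) set"
  assumes p: "p \<noteq> 0" and S: "subspace S" "2 * CARD('n) \<le> dim S + 2"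
    and orth: "\<And>v. v \<in> S \<Longrightarrow> (\<Sum>j\<in>UNIV. v $ j * cnj (p $ j)) = 0"
  shows "S = {v. (\<Sum>j\<in>UNIV. v $ j * cnj (p $ j)) = 0}" (is "S = ?W")
proof (rule subspace_dim_equal)
  let ?T = "span {p, \<i> *s p}"
  have "orthogonal p (\<i> *s p)" "\<i> *s p \<noteq> 0"
    using p by (auto simp: orthogonal_def inner_vec_def inner_complex_def vec_eq_iff)
  then have "pairwise orthogonal {p, \<i> *s p}" "0 \<notin> {p, \<i> *s p}" "p \<noteq> \<i> *s p"
    using p by (auto simp: pairwise_def orthogonal_commute orthogonal_self)
  then have "independent {p, \<i> *s p}" "p \<noteq> \<i> *s p"
    using pairwise_orthogonal_independent by blast+
  then have "dim ?T = 2" by (simp add: dim_eq_card_independent)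
  have W: "?W = {y. \<forall>x\<in>?T. orthogonal x y}"
  proof (intro set_eqI iffI)
    fix y assume "y \<in> ?W"
    then have "orthogonal y x" if "x \<in> {p, \<i> *s p}" for x
      using that Re_hermitian_product[of y p] by (auto simp: orthogonal_def)
    then have "\<forall>x\<in>?T. orthogonal y x" using orthogonal_to_span by blast
    then show "y \<in> {y. \<forall>x\<in>?T. orthogonal x y}" by (simp add: orthogonal_commute)
  next
    fix y assume "y \<in> {y. \<forall>x\<in>?T. orthogonal x y}"
    then have "orthogonal y p" "orthogonal y (\<i> *s p)"
      by (auto simp: orthogonal_commute span_base)
    then show "y \<in> ?W"
      using Re_hermitian_product[of y p] by (simp add: orthogonal_def complex_eq_iff)
  qed
  show "subspace ?W" unfolding W by (rule subspace_orthogonal_to_vectors)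
  have "dim ?W + dim ?T = DIM(complex ^ 'n)"
    using dim_subspace_orthogonal_to_vectors[of ?T UNIV] unfolding W by simp
  then have "dim ?W + 2 = 2 * CARD('n)" using \<open>dim ?T = 2\<close> by simp
  then show "dim ?W \<le> dim S" using S by linarith
qed (use orth S in auto)

text \<open>Multiplication by \<open>\<i>\<close> preserves the range of \<open>A\<close> and
  negates \<open>Q\<close>. Pulled back along the injective \<open>A\<close>, it becomes a real
  linear map \<open>J\<close> that reverses the sign of the diagonal form.\<close>

lemma card_eq_of_complex_quadratic_form:
  fixes A :: "real ^ 'm::finite \<Rightarrow> complex ^ 'n::finite" and L :: "'m set"
  assumes "linear A" "inj A" and cx: "\<And>v. v \<in> range A \<Longrightarrow> \<i> *s v \<in> range A"
    and hom: "\<And>v. Q (\<i> *s v) = - (Q v :: complex)" and "\<kappa> \<noteq> 0"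
    and Q: "\<And>v. Im (Q (A v)) = \<kappa> * (- (\<Sum>i\<in>L. (v $ i)\<^sup>2) + (\<Sum>i\<in>-L. (v $ i)\<^sup>2))"
  shows "2 * card L = CARD('m)"
proof -
  obtain B where B: "linear B" "B \<circ> A = id"
    using linear_injective_left_inverse assms by blast
  define J where "J v = B (\<i> *s A v)" for v
  \<comment> \<open>The left inverse \<open>B\<close> inverts \<open>A\<close> from the right only
    on the range, and \<open>cx\<close> places \<open>\<i> *s A v\<close> there.\<close>
  have AB: "A (B w) = w" if "w \<in> range A" for w
    using that B(2) by (auto simp: fun_eq_iff)
  have AJ: "A (J v) = \<i> *s A v" for v
    unfolding J_def by (intro AB cx) auto
  have "linear (\<lambda>w :: complex ^ 'n. \<i> *s w)"
    by (rule linearI) (simp_all add: vec_eq_iff algebra_simps)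
  from linear_compose[OF linear_compose[OF assms(1) this] B(1)]
  have "linear J" by (simp add: J_def[abs_def] o_def)
  then show ?thesis
  proof (rule card_eq_of_reversing_map)
    fix v
    have "\<kappa> * (- (\<Sum>i\<in>L. (J v $ i)\<^sup>2) + (\<Sum>i\<in>-L. (J v $ i)\<^sup>2))
        = \<kappa> * - (- (\<Sum>i\<in>L. (v $ i)\<^sup>2) + (\<Sum>i\<in>-L. (v $ i)\<^sup>2))"
      using Q[of "J v"] Q[of v] by (simp only: AJ hom uminus_complex.simps mult_minus_right)
    then show "- (\<Sum>i\<in>L. (J v $ i)\<^sup>2) + (\<Sum>i\<in>-L. (J v $ i)\<^sup>2)
        = - (- (\<Sum>i\<in>L. (v $ i)\<^sup>2) + (\<Sum>i\<in>-L. (v $ i)\<^sup>2))"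
      unfolding mult_left_cancel[OF \<open>\<kappa> \<noteq> 0\<close>] .
  qed
qed


section \<open>Second order expansions\<close>

text \<open>The filter is \<open>nhds 0\<close> rather than \<open>at 0\<close> so that an expansion may be composed with curves
  that return to \<open>p\<close>.\<close>

definition quad_jet ::
  "(complex ^ 'n \<Rightarrow> complex) \<Rightarrow> complex ^ 'n::finite \<Rightarrow> (complex ^ 'n \<Rightarrow> complex)
     \<Rightarrow> (complex ^ 'n \<Rightarrow> complex) \<Rightarrow> bool" where
  "quad_jet h p D Q \<longleftrightarrow>
     (\<forall>u v. D (u + v) = D u + D v) \<and> (\<forall>c v. D (c *s v) = c * D v) \<and>
     continuous_on UNIV Q \<and> (\<forall>c v. Q (c *s v) = c\<^sup>2 * Q v) \<and>
     (\<lambda>w. h (p + w) - h p - D w - Q w) \<in> O[nhds 0](\<lambda>w. of_real (norm w) ^ 3)"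

text \<open>The remainder is a separate function \<open>r\<close>, so that a bound proved for a
  differently arranged sum can be supplied together with the identity that rearranges it.\<close>

lemma quad_jetI:
  assumes "\<And>u v. D (u + v) = D u + D v" "\<And>c v. D (c *s v) = c * D v"
    and "continuous_on UNIV Q" "\<And>c v. Q (c *s v) = c\<^sup>2 * Q v"
    and "r \<in> O[nhds 0](\<lambda>w. of_real (norm w) ^ 3)"
    and "\<And>w. r w = h (p + w) - h p - D w - Q w"
  shows "quad_jet h p D Q"
  using assms(1-5) unfolding quad_jet_def assms(6)[symmetric] by simp

lemma quad_jetD:
  assumes "quad_jet h p D Q"
  shows "D (u + v) = D u + D v" "D (c *s v) = c * D v" "continuous_on UNIV Q"
    "Q (c *s v) = c\<^sup>2 * Q v"
    "(\<lambda>w. h (p + w) - h p - D w - Q w) \<in> O[nhds 0](\<lambda>w. of_real (norm w) ^ 3)"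
  using assms by (simp_all add: quad_jet_def)

lemma quad_jet_bounded_linear:
  assumes "quad_jet h p D Q"
  shows "bounded_linear D"
proof -
  have "linear D"
    using assms unfolding quad_jet_def
    by (intro linearI) (auto simp: scaleR_eq_of_real_vector_mult scaleR_conv_of_real)
  then show ?thesis by (simp add: linear_conv_bounded_linear)
qed

section \<open>Growth of the terms of an expansion\<close>

lemma norm_pow_bigo:
  assumes "k \<le> l"
  shows "(\<lambda>w::'a::real_normed_vector. of_real (norm w) ^ l :: complex)
           \<in> O[nhds 0](\<lambda>w. of_real (norm w) ^ k)"
proof (rule bigoI[where c=1])
  have "\<forall>\<^sub>F w::'a in nhds 0. norm w < 1"
    using eventually_nhds_metric[of "\<lambda>w. norm w < 1" "0::'a"] by (auto intro!: exI[of _ 1])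
  then show "\<forall>\<^sub>F w::'a in nhds 0. norm (of_real (norm w) ^ l :: complex)
               \<le> 1 * norm (of_real (norm w) ^ k :: complex)"
    by eventually_elim (use assms in \<open>simp add: norm_power power_decreasing\<close>)
qed

lemma quad_jet_linear_part_bigo:
  assumes "quad_jet h p D Q"
  shows "D \<in> O[nhds 0](\<lambda>w. of_real (norm w))"
proof -
  interpret bounded_linear D using quad_jet_bounded_linear[OF assms] .
  obtain K where "\<And>x. norm (D x) \<le> norm x * K" using bounded by blast
  then show ?thesis by (intro bigoI[where c=K]) (simp add: mult.commute)
qed

text \<open>All that is known of \<open>Q\<close> is continuity and homogeneity of degree 2.
  Compactness of the unit sphere gives a bound there, and scaling extends it to all vectors.\<close>

lemma quad_jet_quadratic_part_bigo:
  assumes "quad_jet h p D Q"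
  shows "Q \<in> O[nhds 0](\<lambda>w. of_real (norm w) ^ 2)"
proof -
  have hom: "Q (c *s v) = c\<^sup>2 * Q v" for c v using assms by (simp add: quad_jet_def)
  have "compact (Q ` sphere 0 1)"
    using assms by (intro compact_continuous_image) (auto simp: quad_jet_def intro: continuous_on_subset)
  then have "bounded (Q ` sphere 0 1)" by (rule compact_imp_bounded)
  then obtain K where "\<forall>v\<in>sphere 0 1. norm (Q v) \<le> K"
    unfolding bounded_iff by auto
  then have K: "norm (Q v) \<le> K" if "norm v = 1" for v
    using that by simp
  have "norm (Q w) \<le> K * norm w ^ 2" for w
  proof (cases "w = 0")
    case True
    then show ?thesis using hom[of 0 0] by simp
  next
    case False
    define v where "v = inverse (norm w) *\<^sub>R w"
    have "norm v = 1" using False by (simp add: v_def)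
    have "w = of_real (norm w) *s v"
      using False by (simp add: v_def scaleR_eq_of_real_vector_mult vector_smult_assoc)
    then have "norm (Q w) = norm w ^ 2 * norm (Q v)"
      using hom[of "of_real (norm w)" v] by (simp add: norm_mult norm_power)
    also have "\<dots> \<le> norm w ^ 2 * K" using K[OF \<open>norm v = 1\<close>] by (intro mult_left_mono) auto
    finally show ?thesis by (simp add: mult.commute)
  qed
  then show ?thesis by (intro bigoI[where c=K]) (simp add: norm_power)
qed

text \<open>Each bound follows from the previous one by adding back one term of the expansion, which
  lowers the order by one. The last is local boundedness of \<open>h\<close>.\<close>

lemma quad_jet_remainder_bigo:
  assumes "quad_jet h p D Q"
  shows "(\<lambda>w. h (p + w) - h p - D w) \<in> O[nhds 0](\<lambda>w. of_real (norm w) ^ 2)"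
    and "(\<lambda>w. h (p + w) - h p) \<in> O[nhds 0](\<lambda>w. of_real (norm w))"
    and "(\<lambda>w. h (p + w)) \<in> O[nhds 0](\<lambda>w. 1)"
proof -
  have R: "(\<lambda>w. h (p + w) - h p - D w - Q w) \<in> O[nhds 0](\<lambda>w. of_real (norm w) ^ 3)"
    using assms by (simp add: quad_jet_def)
  have "(\<lambda>w. (h (p + w) - h p - D w - Q w) + Q w) \<in> O[nhds 0](\<lambda>w. of_real (norm w) ^ 2)"
    by (intro sum_in_bigo quad_jet_quadratic_part_bigo[OF assms] landau_o.big_trans[OF R] norm_pow_bigo) auto
  then show 1: "(\<lambda>w. h (p + w) - h p - D w) \<in> O[nhds 0](\<lambda>w. of_real (norm w) ^ 2)" by simp
  have "(\<lambda>w. (h (p + w) - h p - D w) + D w) \<in> O[nhds 0](\<lambda>w. of_real (norm w))"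
    using norm_pow_bigo[of 1 2]
    by (intro sum_in_bigo quad_jet_linear_part_bigo[OF assms] landau_o.big_trans[OF 1]) auto
  then show 2: "(\<lambda>w. h (p + w) - h p) \<in> O[nhds 0](\<lambda>w. of_real (norm w))" by simp
  have "(\<lambda>w. (h (p + w) - h p) + h p) \<in> O[nhds 0](\<lambda>w. 1)"
    using norm_pow_bigo[of 0 1]
    by (intro sum_in_bigo landau_o.big_trans[OF 2]) auto
  then show "(\<lambda>w. h (p + w)) \<in> O[nhds 0](\<lambda>w. 1)" by simp
qed

section \<open>Expansions of sums, products and polynomials\<close>

lemma quad_jet_const: "quad_jet (\<lambda>_. c) p (\<lambda>_. 0) (\<lambda>_. 0)"
  by (simp add: quad_jet_def)

lemma quad_jet_component: "quad_jet (\<lambda>z. z $ j) p (\<lambda>w. w $ j) (\<lambda>_. 0)"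
  by (simp add: quad_jet_def)

lemma quad_jet_add:
  assumes "quad_jet h1 p D1 Q1" "quad_jet h2 p D2 Q2"
  shows "quad_jet (\<lambda>z. h1 z + h2 z) p (\<lambda>w. D1 w + D2 w) (\<lambda>w. Q1 w + Q2 w)"
proof -
  note j1 = quad_jetD[OF assms(1)] and j2 = quad_jetD[OF assms(2)]
  show ?thesis
    by (rule quad_jetI[OF _ _ _ _ sum_in_bigo(1)[OF j1(5) j2(5)]])
       (auto simp: j1 j2 algebra_simps intro: continuous_on_add)
qed

lemma quad_jet_mult:
  assumes 1: "quad_jet h1 p D1 Q1" and 2: "quad_jet h2 p D2 Q2"
  shows "quad_jet (\<lambda>z. h1 z * h2 z) p (\<lambda>w. h1 p * D2 w + D1 w * h2 p)
           (\<lambda>w. h1 p * Q2 w + D1 w * D2 w + Q1 w * h2 p)"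
proof -
  note b1 = quad_jet_linear_part_bigo[OF 1] quad_jet_quadratic_part_bigo[OF 1]
  note b2 = quad_jet_remainder_bigo[OF 2]
  have R: "(\<lambda>w. h1 (p + w) - h1 p - D1 w - Q1 w) \<in> O[nhds 0](\<lambda>w. of_real (norm w) ^ 3)"
          "(\<lambda>w. h2 (p + w) - h2 p - D2 w - Q2 w) \<in> O[nhds 0](\<lambda>w. of_real (norm w) ^ 3)"
    using assms by (simp_all add: quad_jet_def)
  \<comment> \<open>The four summands add up exactly to the remainder of the product. Their orders
    are 0 + 3, 3 + 0, 1 + 2 and 2 + 1.\<close>
  have "(\<lambda>w. h1 p * (h2 (p + w) - h2 p - D2 w - Q2 w)
            + (h1 (p + w) - h1 p - D1 w - Q1 w) * h2 (p + w)
            + D1 w * (h2 (p + w) - h2 p - D2 w)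
            + Q1 w * (h2 (p + w) - h2 p)) \<in> O[nhds 0](\<lambda>w. of_real (norm w) ^ 3)"
    using landau_o.big.mult[OF R(1) b2(3)] landau_o.big.mult[OF b1(1) b2(1)]
      landau_o.big.mult[OF b1(2) b2(2)] R(2)
    by (intro sum_in_bigo) (auto simp: power2_eq_square power3_eq_cube mult.assoc)
  note R = this
  have "continuous_on UNIV D1" "continuous_on UNIV D2"
    using quad_jet_bounded_linear assms linear_continuous_on by blast+
  then show ?thesis
    by (intro quad_jetI[OF _ _ _ _ R])
       (auto simp: quad_jetD(1,2,4)[OF 1] quad_jetD(1,2,4)[OF 2] algebra_simps power2_eq_square
         intro!: continuous_intros quad_jetD(3)[OF 1] quad_jetD(3)[OF 2])
qed

lemma quad_jet_cmult:
  assumes "quad_jet h p D Q"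
  shows "quad_jet (\<lambda>z. c * h z) p (\<lambda>w. c * D w) (\<lambda>w. c * Q w)"
  using quad_jet_mult[OF quad_jet_const assms, of c] by simp

text \<open>Polynomials arise from constants and coordinate functions by sums and products. Bare
  existence suffices: \<open>D\<close> is identified below through partial derivatives, and of
  \<open>Q\<close> only its homogeneity and continuity matter.\<close>

lemma quad_jet_poly_eval: "\<exists>D Q. quad_jet (poly_eval P) p D Q"
proof -
  let ?J = "\<lambda>h. \<exists>D Q. quad_jet h p D Q"
  have const: "?J (\<lambda>_. c)" for c using quad_jet_const by blast
  have mult: "?J (\<lambda>z. h1 z * h2 z)" if "?J h1" "?J h2" for h1 h2
    using that quad_jet_mult by blast
  have add: "?J (\<lambda>z. h1 z + h2 z)" if "?J h1" "?J h2" for h1 h2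
    using that quad_jet_add by blast
  have pow: "?J (\<lambda>z. (z $ j) ^ k)" for j k
  proof (induction k)
    case (Suc k)
    have "?J (\<lambda>z. z $ j)" using quad_jet_component by blast
    from mult[OF this Suc] show ?case by simp
  qed (simp add: const)
  have prod: "?J (\<lambda>z. \<Prod>j\<in>A. (z $ j) ^ k j)" if "finite A" for A k
    using that by (induction A rule: finite_induct) (simp_all add: const mult pow)
  have "?J (\<lambda>z. \<Sum>\<alpha>\<in>B. c \<alpha> * (\<Prod>j\<in>UNIV. (z $ j) ^ k \<alpha> j))"
    if "finite B" for B and c :: "('a \<Rightarrow>\<^sub>0 nat) \<Rightarrow> complex" and k
    using that by (induction B rule: finite_induct) (simp_all add: const mult add prod)
  then show ?thesis unfolding poly_eval_def[abs_def] by simp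
qed

text \<open>On the ball of radius 1/2 the modulus of \<open>1 + z\<close> is at least 1/2, so the
  third derivative \<open>2 / (1 + z) ^ 3\<close> is bounded by 16. The Taylor remainder
  \<open>16 * norm y ^ 3 / fact 2\<close> then yields the constant 8.\<close>

lemma Ln_quadratic_approx:
  "(\<lambda>y. Ln (1 + y) - y + y\<^sup>2 / 2) \<in> O[nhds 0](\<lambda>y. y ^ 3)"
proof (rule bigoI[where c=8])
  \<comment> \<open>\<open>F\<close> lists \<open>Ln (1 + z)\<close> and its first three
    derivatives; the default branch stands for index 3.\<close>
  define F where "F k = (case k of 0 \<Rightarrow> \<lambda>z. Ln (1 + z) | Suc 0 \<Rightarrow> \<lambda>z. inverse (1 + z)
      | Suc (Suc 0) \<Rightarrow> \<lambda>z. - inverse ((1 + z)\<^sup>2) | _ \<Rightarrow> \<lambda>z::complex. 2 * inverse ((1 + z) ^ 3))" for k :: nat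
  have nz: "1 / 2 \<le> norm (1 + z)" "1 + z \<notin> \<real>\<^sub>\<le>\<^sub>0" "1 + z \<noteq> 0" if "z \<in> ball 0 (1/2)" for z :: complex
  proof -
    have "norm (1 :: complex) \<le> norm (1 + z) + norm z"
      by (metis add_diff_cancel_right' norm_triangle_ineq4)
    then show "1 / 2 \<le> norm (1 + z)" using that by simp
    then show "1 + z \<noteq> 0" by auto
    have "Re (1 + z) > 0" using that abs_Re_le_cmod[of z] by simp
    then show "1 + z \<notin> \<real>\<^sub>\<le>\<^sub>0" using complex_nonpos_Reals_iff by auto
  qed
  have "norm (F 0 y - (\<Sum>i\<le>2. F i 0 * (y - 0) ^ i / fact i)) \<le> 16 * norm (y - 0) ^ Suc 2 / fact 2"
    if "y \<in> ball 0 (1/2)" for y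
  proof (rule complex_Taylor[where S="ball 0 (1/2)"])
    fix i :: nat and x :: complex assume x: "x \<in> ball 0 (1/2)" "i \<le> 2"
    note nz = nz[OF x(1)]
    have "(F 0 has_field_derivative F 1 x) (at x within ball 0 (1/2))"
      using nz by (auto simp: F_def field_simps intro!: derivative_eq_intros)
    moreover have "(F 1 has_field_derivative F 2 x) (at x within ball 0 (1/2))"
      using nz by (auto simp: F_def numeral_2_eq_2 field_simps power2_eq_square intro!: derivative_eq_intros)
    moreover have "(F 2 has_field_derivative F 3 x) (at x within ball 0 (1/2))"
      using nz(3) unfolding F_def numeral_2_eq_2 numeral_3_eq_3 nat.case
      by (auto intro!: derivative_eq_intros simp: divide_simps power_eq_if)
    ultimately show "(F i has_field_derivative F (Suc i) x) (at x within ball 0 (1/2))"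
      using x(2) by (auto simp: le_Suc_eq numeral_2_eq_2 numeral_3_eq_3)
  next
    fix x :: complex assume x: "x \<in> ball 0 (1/2)"
    have "(1 / 2) ^ 3 \<le> norm (1 + x) ^ 3" using nz[OF x] by (intro power_mono) auto
    then have "2 * inverse (norm (1 + x) ^ 3) \<le> 2 * inverse ((1 / 2 :: real) ^ 3)"
      by (intro mult_left_mono le_imp_inverse_le) auto
    then show "norm (F (Suc 2) x) \<le> 16"
      by (simp add: F_def numeral_2_eq_2 norm_mult norm_inverse norm_power power_divide)
  qed (use that in auto)
  note taylor = this
  have bound: "norm (Ln (1 + y) - y + y\<^sup>2 / 2) \<le> 8 * norm (y ^ 3)" if "norm y < 1/2" for y
    using taylor[of y] that
    by (simp add: F_def numeral_2_eq_2 norm_power norm_mult atMost_Suc algebra_simps power3_eq_cube)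
  have "\<forall>\<^sub>F y::complex in nhds 0. norm y < 1/2"
    using eventually_nhds_metric[of "\<lambda>y. norm y < 1/2" "0::complex"] by (auto intro!: exI[of _ "1/2"])
  then show "\<forall>\<^sub>F y in nhds 0. norm (Ln (1 + y) - y + y\<^sup>2 / 2) \<le> 8 * norm (y ^ 3)"
    by eventually_elim (rule bound)
qed

section \<open>The linear part as a derivative\<close>

lemma quad_jet_has_derivative:
  assumes "quad_jet h p D Q"
  shows "(h has_derivative D) (at p)"
proof -
  obtain C where C: "\<forall>\<^sub>F w in nhds 0. norm (h (p + w) - h p - D w) \<le> C * norm w ^ 2"
    using landau_o.bigE[OF quad_jet_remainder_bigo(1)[OF assms]] by (auto simp: norm_power)
  have "((\<lambda>w. norm (h (p + w) - h p - D w) / norm w) \<longlongrightarrow> 0) (at 0)"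
  proof (rule Lim_null_comparison)
    show "\<forall>\<^sub>F w in at 0. norm (norm (h (p + w) - h p - D w) / norm w) \<le> C * norm w"
      using C unfolding eventually_at_filter
      by eventually_elim (auto simp: field_simps power2_eq_square)
    show "((\<lambda>w. C * norm w) \<longlongrightarrow> 0) (at 0)" by (auto intro!: tendsto_eq_intros)
  qed
  then show ?thesis
    unfolding has_derivative_at using quad_jet_bounded_linear[OF assms] by blast
qed

text \<open>By complex linearity \<open>D\<close> is determined on the coordinate vectors. Its
  values there are the derivatives of \<open>h\<close> along the complex lines through
  \<open>p\<close> on which \<open>cpartial\<close> is computed.\<close>

lemma quad_jet_linear_part:
  assumes "quad_jet h p D Q"
  shows "D w = (\<Sum>j\<in>UNIV. w $ j * cpartial j h p)"
proof -
  have hom: "D (c *s v) = c * D v" for c v using assms by (simp add: quad_jet_def)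
  have "cpartial j h p = D (axis j 1)" for j
  proof -
    define \<gamma> where "\<gamma> t = p + (t - p $ j) *s axis j 1" for t
    have \<gamma>: "\<gamma> t = (\<chi> k. if k = j then t else p $ k)" for t
      by (simp add: \<gamma>_def vec_eq_iff axis_def)
    have "bounded_linear (\<lambda>t::complex. t *s (axis j 1 :: complex ^ 'a))"
      by (intro linear_conv_bounded_linear[THEN iffD1] linearI)
         (auto simp: vec_eq_iff algebra_simps)
    then have "(\<gamma> has_derivative (\<lambda>t. t *s axis j 1)) (at (p $ j))"
      unfolding \<gamma>_def
      by (auto intro!: derivative_eq_intros bounded_linear.has_derivative[of "\<lambda>t. t *s axis j 1"])
    moreover have "(h has_derivative D) (at (\<gamma> (p $ j)))"
      using quad_jet_has_derivative[OF assms] by (simp add: \<gamma>_def)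
    ultimately have "((\<lambda>t. h (\<gamma> t)) has_derivative (\<lambda>t. D (t *s axis j 1))) (at (p $ j))"
      using has_derivative_compose by blast
    then have "((\<lambda>t. h (\<gamma> t)) has_field_derivative D (axis j 1)) (at (p $ j))"
      unfolding has_field_derivative_def hom by (simp add: mult.commute mult_commute_abs)
    then show ?thesis unfolding cpartial_def \<gamma> by (rule DERIV_imp_deriv)
  qed
  moreover have "D w = (\<Sum>j\<in>UNIV. w $ j * D (axis j 1))"
  proof -
    have "D w = D (\<Sum>j\<in>UNIV. w $ j *s axis j 1)" by (simp add: basis_expansion)
    also have "\<dots> = (\<Sum>j\<in>UNIV. D (w $ j *s axis j 1))"
      using quad_jet_bounded_linear[OF assms] bounded_linear.linear linear_sum by blast
    finally show ?thesis by (simp add: hom)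
  qed
  ultimately show ?thesis by simp
qed

text \<open>The relative increment \<open>y\<close> of \<open>h\<close> is substituted into the
  expansion of \<open>Ln (1 + y)\<close>. Dividing by \<open>h p\<close> makes the argument 1 at
  \<open>p\<close>, away from the branch cut. The square of the linear part of \<open>y\<close>
  enters the new quadratic part.\<close>

lemma quad_jet_Ln:
  assumes jet: "quad_jet h p D Q" and nz: "h p \<noteq> 0"
  shows "quad_jet (\<lambda>z. Ln (h z / h p)) p (\<lambda>w. D w / h p) (\<lambda>w. Q w / h p - (D w / h p)\<^sup>2 / 2)"
proof -
  let ?N = "\<lambda>w. of_real (norm w) :: complex"
  define y where "y w = h (p + w) / h p - 1" for w
  define E where "E w = D w / h p" for w
  have y: "quad_jet (\<lambda>z. inverse (h p) * h z) p (\<lambda>w. inverse (h p) * D w) (\<lambda>w. inverse (h p) * Q w)"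
    using jet by (rule quad_jet_cmult)
  have y_eq: "y w = inverse (h p) * h (p + w) - inverse (h p) * h p" for w
    using nz by (simp add: y_def field_simps)
  have yN: "y \<in> O[nhds 0](?N)" "(\<lambda>w. y w - E w) \<in> O[nhds 0](\<lambda>w. ?N w ^ 2)"
    and E: "E \<in> O[nhds 0](?N)"
    and yR: "(\<lambda>w. y w - E w - Q w / h p) \<in> O[nhds 0](\<lambda>w. ?N w ^ 3)"
    using quad_jet_remainder_bigo[OF y] quad_jet_linear_part_bigo[OF y] y
    unfolding y_eq[abs_def] E_def[abs_def] quad_jet_def by (simp_all add: divide_inverse mult.commute)
  have "isCont h p"
    using quad_jet_has_derivative[OF jet] has_derivative_continuous by blast
  then have "((\<lambda>w. h (p + w)) \<longlongrightarrow> h (p + 0)) (nhds 0)"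
    by (intro isCont_tendsto_compose[of "p + 0" h] tendsto_intros filterlim_ident) (auto simp: isCont_def)
  then have lim: "filterlim y (nhds 0) (nhds 0)"
    unfolding y_def using nz by (auto intro!: tendsto_eq_intros)
  have "(\<lambda>w. Ln (1 + y w) - y w + (y w)\<^sup>2 / 2) \<in> O[nhds 0](\<lambda>w. y w ^ 3)"
    using landau_o.big.compose[OF Ln_quadratic_approx lim] .
  also have "(\<lambda>w. y w ^ 3) \<in> O[nhds 0](\<lambda>w. ?N w ^ 3)"
    using yN(1) by (rule landau_o.big_power)
  finally have 1: "(\<lambda>w. Ln (1 + y w) - y w + (y w)\<^sup>2 / 2) \<in> O[nhds 0](\<lambda>w. ?N w ^ 3)" .
  \<comment> \<open>This product is the difference of the squares of \<open>y w\<close> and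
    \<open>E w\<close>, so replacing the one square by the other costs only a cubic error.\<close>
  have "(\<lambda>w. (y w - E w) * (y w + E w)) \<in> O[nhds 0](\<lambda>w. ?N w ^ 2 * ?N w)"
    by (intro landau_o.big.mult yN sum_in_bigo E)
  then have 2: "(\<lambda>w. (y w - E w) * (y w + E w) / 2) \<in> O[nhds 0](\<lambda>w. ?N w ^ 3)"
    by (simp add: power2_eq_square power3_eq_cube)
  have "(\<lambda>w. (Ln (1 + y w) - y w + (y w)\<^sup>2 / 2) - (y w - E w) * (y w + E w) / 2
            + (y w - E w - Q w / h p)) \<in> O[nhds 0](\<lambda>w. ?N w ^ 3)"
    by (intro sum_in_bigo 1 2 yR)
  note R = this
  have R_eq: "(Ln (1 + y w) - y w + (y w)\<^sup>2 / 2) - (y w - E w) * (y w + E w) / 2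
            + (y w - E w - Q w / h p)
      = Ln (h (p + w) / h p) - Ln (h p / h p) - D w / h p - (Q w / h p - (D w / h p)\<^sup>2 / 2)" for w
  proof -
    have "(y w - E w) * (y w + E w) / 2 = (y w)\<^sup>2 / 2 - (E w)\<^sup>2 / 2"
      by (simp add: power2_eq_square algebra_simps diff_divide_distrib)
    then show ?thesis using nz by (simp only:) (simp add: E_def y_def)
  qed
  have "continuous_on UNIV D"
    using quad_jet_bounded_linear[OF jet] linear_continuous_on by blast
  then show ?thesis
    using nz by (intro quad_jetI[OF _ _ _ _ R R_eq])
      (auto simp: quad_jetD(1,2,4)[OF jet] field_simps power2_eq_square
        intro!: continuous_intros quad_jetD(3)[OF jet])
qed

text \<open>Since the linear part vanishes, the second order term of the curve contributes nothing.
  The limit depends on the velocity alone, and one derivative of the curve suffices.\<close>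

lemma quad_jet_limit_along_curve:
  fixes \<gamma> :: "real \<Rightarrow> complex ^ 'n::finite"
  assumes jet: "quad_jet h p (\<lambda>_. 0) Q" and \<gamma>: "(\<gamma> has_vector_derivative v) (at 0)" "\<gamma> 0 = p"
  shows "((\<lambda>t. (h (\<gamma> t) - h p) / of_real (t\<^sup>2)) \<longlongrightarrow> Q v) (at 0)"
proof -
  define \<Delta> where "\<Delta> t = \<gamma> t - p" for t
  have quot: "((\<lambda>t. inverse t *\<^sub>R \<Delta> t) \<longlongrightarrow> v) (at 0)"
  proof -
    have "(\<lambda>t. norm (\<gamma> (0 + t) - \<gamma> 0 - t *\<^sub>R v) / norm t) \<midarrow>0\<rightarrow> 0"
      using \<gamma>(1) by (simp add: has_vector_derivative_def has_derivative_at)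
    then have "(\<lambda>t. norm (inverse t *\<^sub>R \<Delta> t - v)) \<midarrow>0\<rightarrow> 0"
    proof (rule Lim_transform_eventually)
      have "norm (\<gamma> (0 + t) - \<gamma> 0 - t *\<^sub>R v) / norm t = norm (inverse t *\<^sub>R \<Delta> t - v)"
        if "t \<noteq> 0" for t
      proof -
        have "inverse t *\<^sub>R \<Delta> t - v = inverse t *\<^sub>R (\<Delta> t - t *\<^sub>R v)"
          using that by (simp add: scaleR_diff_right)
        then show ?thesis using \<gamma>(2) by (simp add: \<Delta>_def divide_inverse mult.commute)
      qed
      then show "\<forall>\<^sub>F t in at 0. norm (\<gamma> (0 + t) - \<gamma> 0 - t *\<^sub>R v) / norm t
          = norm (inverse t *\<^sub>R \<Delta> t - v)"
        by (simp add: eventually_at_filter)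
    qed
    from LIM_zero_cancel[OF tendsto_norm_zero_cancel[OF this]] show ?thesis .
  qed
  have \<Delta>0: "(\<Delta> \<longlongrightarrow> 0) (at 0)"
    using has_vector_derivative_continuous[OF \<gamma>(1)] \<gamma>(2)
    unfolding \<Delta>_def[abs_def] continuous_within by (simp only: LIM_zero)
  obtain C where "\<forall>\<^sub>F w in nhds 0. norm (h (p + w) - h p - Q w) \<le> C * norm w ^ 3"
    using landau_o.bigE[OF quad_jetD(5)[OF jet]] by (auto simp: norm_power)
  then have "\<forall>\<^sub>F t in at 0. norm (h (p + \<Delta> t) - h p - Q (\<Delta> t)) \<le> C * norm (\<Delta> t) ^ 3"
    using \<Delta>0 unfolding filterlim_iff by auto
  moreover have "\<forall>\<^sub>F t in at (0::real). t \<noteq> 0" by (simp add: eventually_at_filter)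
  \<comment> \<open>By homogeneity, \<open>Q\<close> at the difference quotient is
    \<open>Q (\<Delta> t)\<close> divided by the square of \<open>t\<close>, so the left side is the
    cubic remainder divided by that square.\<close>
  ultimately have "\<forall>\<^sub>F t in at 0. norm ((h (\<gamma> t) - h p) / of_real (t\<^sup>2) - Q (inverse t *\<^sub>R \<Delta> t))
      \<le> C * norm (inverse t *\<^sub>R \<Delta> t) ^ 2 * norm (\<Delta> t)"
  proof eventually_elim
    case (elim t)
    have "Q (inverse t *\<^sub>R \<Delta> t) = Q (\<Delta> t) / of_real (t\<^sup>2)"
      unfolding scaleR_eq_of_real_vector_mult quad_jetD(4)[OF jet]
      by (simp add: field_simps power2_eq_square)
    then have "norm ((h (\<gamma> t) - h p) / of_real (t\<^sup>2) - Q (inverse t *\<^sub>R \<Delta> t))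
        = norm (h (p + \<Delta> t) - h p - Q (\<Delta> t)) / t\<^sup>2"
      by (simp add: \<Delta>_def diff_divide_distrib[symmetric] norm_divide norm_power)
    also have "\<dots> \<le> C * norm (\<Delta> t) ^ 3 / t\<^sup>2" using elim by (intro divide_right_mono) auto
    also have "\<dots> = C * norm (inverse t *\<^sub>R \<Delta> t) ^ 2 * norm (\<Delta> t)"
      by (simp add: power_mult_distrib power2_eq_square power3_eq_cube field_simps)
    finally show ?case .
  qed
  moreover have "((\<lambda>t. C * norm (inverse t *\<^sub>R \<Delta> t) ^ 2 * norm (\<Delta> t)) \<longlongrightarrow> 0) (at 0)"
    by (rule tendsto_eq_intros quot \<Delta>0 | simp)+
  ultimately have "((\<lambda>t. (h (\<gamma> t) - h p) / of_real (t\<^sup>2) - Q (inverse t *\<^sub>R \<Delta> t)) \<longlongrightarrow> 0) (at 0)"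
    by (rule Lim_null_comparison)
  moreover have "((\<lambda>t. Q (inverse t *\<^sub>R \<Delta> t)) \<longlongrightarrow> Q v) (at 0)"
    by (rule continuous_on_tendsto_compose[OF quad_jetD(3)[OF jet] quot]) auto
  ultimately show ?thesis by (rule Lim_transform[rotated])
qed


section \<open>Fold charts\<close>

lemma smooth_on_differentiable:
  assumes "smooth_on U f" "x \<in> U"
  shows "f differentiable (at x)"
  using assms(1)[unfolded smooth_on_def, rule_format, of "Suc 0"] assms(2) by simp

text \<open>Turns a chart into a parametrization. Differentiating \<open>x (\<psi> z) = z\<close> on
  the open set \<open>X\<close> shows that \<open>x'\<close> is a left inverse of
  \<open>\<psi>'\<close>, hence that \<open>\<psi>'\<close> is injective.\<close>

lemma local_coords_inverse:
  assumes "local_coords M p U x"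
  obtains X \<psi> \<psi>' x' where "open X" "0 \<in> X" "\<psi> 0 = p"
    "\<And>z. z \<in> X \<Longrightarrow> \<psi> z \<in> U \<inter> M \<and> x (\<psi> z) = z" "\<And>q. q \<in> U \<inter> M \<Longrightarrow> \<psi> (x q) = q"
    "(\<psi> has_derivative \<psi>') (at 0)" "(x has_derivative x') (at p)" "\<And>v. x' (\<psi>' v) = v"
proof -
  define X where "X = x ` (U \<inter> M)"
  obtain \<psi> where \<psi>: "smooth_on X \<psi>" "\<And>q. q \<in> U \<inter> M \<Longrightarrow> \<psi> (x q) = q"
    using assms unfolding local_coords_def X_def by blast
  have x: "open X" "p \<in> U \<inter> M" "x p = 0" "smooth_on U x"
    using assms by (auto simp: local_coords_def X_def)
  then have "0 \<in> X" "\<psi> 0 = p" using \<psi>(2)[of p] by (force simp: X_def)+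
  have inv: "\<psi> z \<in> U \<inter> M \<and> x (\<psi> z) = z" if "z \<in> X" for z
    using that \<psi>(2) by (auto simp: X_def)
  obtain \<psi>' where \<psi>': "(\<psi> has_derivative \<psi>') (at 0)"
    using smooth_on_differentiable[OF \<psi>(1) \<open>0 \<in> X\<close>] by (auto simp: differentiable_def)
  obtain x' where x': "(x has_derivative x') (at p)"
    using smooth_on_differentiable[OF x(4)] x(2) by (auto simp: differentiable_def)
  have "((\<lambda>z. x (\<psi> z)) has_derivative (\<lambda>v. x' (\<psi>' v))) (at 0)"
    using has_derivative_compose[OF \<psi>', of x x'] x' \<open>\<psi> 0 = p\<close> by simp
  then have "((\<lambda>z. z) has_derivative (\<lambda>v. x' (\<psi>' v))) (at 0)"
    by (rule has_derivative_transform_within_open[OF _ \<open>open X\<close> \<open>0 \<in> X\<close>]) (use inv in auto)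
  then have "(\<lambda>v. x' (\<psi>' v)) = (\<lambda>v. v)"
    using has_derivative_unique has_derivative_ident by blast
  then show thesis
    using that[of X \<psi> \<psi>' x'] x \<psi> \<psi>' x' inv \<open>0 \<in> X\<close> \<open>\<psi> 0 = p\<close> by (auto simp: fun_eq_iff)
qed

section \<open>Angle coordinates on the torus\<close>

definition torus_angles :: "complex \<times> complex \<Rightarrow> complex \<times> complex \<Rightarrow> real \<times> real" where
  "torus_angles u\<^sub>0 u = (Im (Ln (fst u / fst u\<^sub>0)), Im (Ln (snd u / snd u\<^sub>0)))"

lemma cis_Im_Ln:
  assumes "norm (z :: complex) = 1"
  shows "cis (Im (Ln z)) = z"
proof -
  have "z \<noteq> 0" using assms by auto
  then have "Re (Ln z) = 0" using assms by (simp add: Re_Ln)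
  then have "exp (Ln z) = cis (Im (Ln z))" by (simp add: exp_eq_polar)
  then show ?thesis using \<open>z \<noteq> 0\<close> by simp
qed

text \<open>\<open>T\<close> is the change of coordinates from an arbitrary chart to the angles
  measured from the base point. Both logarithms have argument 1 at that point, so the angles are
  differentiable there.\<close>

lemma torus_angles_chart:
  assumes coords: "local_coords torus u\<^sub>0 V y"
  obtains T T' where "T (0 :: real \<times> real) = 0" "(T has_derivative T') (at 0)" "surj T'"
    "\<And>u. u \<in> V \<inter> torus \<Longrightarrow> torus_angles u\<^sub>0 u = T (y u)"
proof -
  obtain X \<psi> \<psi>' y' where X: "open X" "0 \<in> X" "\<psi> 0 = u\<^sub>0"
    and \<psi>: "\<And>z. z \<in> X \<Longrightarrow> \<psi> z \<in> V \<inter> torus \<and> y (\<psi> z) = z" "\<And>u. u \<in> V \<inter> torus \<Longrightarrow> \<psi> (y u) = u"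
    and d: "(\<psi> has_derivative \<psi>') (at 0)" "(y has_derivative y') (at u\<^sub>0)"
    using local_coords_inverse[OF coords] by metis
  define T where "T z = torus_angles u\<^sub>0 (\<psi> z)" for z
  define E where "E = (\<lambda>(a, b). (fst u\<^sub>0 * cis a, snd u\<^sub>0 * cis b))"
  have u0: "norm (fst u\<^sub>0) = 1" "norm (snd u\<^sub>0) = 1"
    using \<psi>(1)[OF X(2)] X(3) by (auto simp: torus_def)
  then have nz: "fst u\<^sub>0 \<noteq> 0" "snd u\<^sub>0 \<noteq> 0" by auto
  \<comment> \<open>This holds on the whole torus: \<open>cis\<close> recovers a unit complex number
    from its principal argument, even across the branch cut.\<close>
  have E: "E (torus_angles u\<^sub>0 u) = u" if "u \<in> torus" for u
    using that u0 nz by (cases u) (auto simp: E_def torus_angles_def torus_def cis_Im_Ln norm_divide)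
  have "(Ln has_derivative (\<lambda>h. h)) (at 1)"
    using has_field_derivative_Ln[of 1] by (simp add: has_field_derivative_def mult_1[abs_def])
  then have Ln': "((\<lambda>u. Ln (k u / k u\<^sub>0)) has_derivative (\<lambda>v. k v / k u\<^sub>0)) (at u\<^sub>0)"
    if "bounded_linear k" "k u\<^sub>0 \<noteq> 0" for k :: "complex \<times> complex \<Rightarrow> complex"
  proof -
    have "((\<lambda>u. k u / k u\<^sub>0) has_derivative (\<lambda>v. k v / k u\<^sub>0)) (at u\<^sub>0)"
      using bounded_linear_imp_has_derivative[OF that(1)] that(2)
      by (simp add: divide_inverse has_derivative_mult_left)
    from has_derivative_compose[OF this, of Ln "\<lambda>h. h"] show ?thesis
      using \<open>(Ln has_derivative (\<lambda>h. h)) (at 1)\<close> that(2) by simp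
  qed
  have "(torus_angles u\<^sub>0 has_derivative (\<lambda>v. (Im (fst v / fst u\<^sub>0), Im (snd v / snd u\<^sub>0)))) (at u\<^sub>0)"
    unfolding torus_angles_def[abs_def] using nz
    by (intro has_derivative_Pair has_derivative_Im Ln' bounded_linear_fst bounded_linear_snd)
  from has_derivative_compose[OF d(1) this[folded X(3)]]
  obtain T' where T': "(T has_derivative T') (at 0)"
    unfolding T_def[abs_def] X(3) by blast
  have T0: "T 0 = 0" using nz X(3) by (simp add: T_def torus_angles_def zero_prod_def)
  have "((\<lambda>z. (fst u\<^sub>0 * exp (\<i> * of_real (fst z)), snd u\<^sub>0 * exp (\<i> * of_real (snd z))))
      has_derivative (\<lambda>v. (fst u\<^sub>0 * (\<i> * of_real (fst v)), snd u\<^sub>0 * (\<i> * of_real (snd v))))) (at 0)"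
  proof -
    have "(exp has_derivative (\<lambda>h. h)) (at (0 :: complex))"
      using DERIV_exp[of "0 :: complex"] by (simp add: has_field_derivative_def mult_1[abs_def])
    then have exp': "((\<lambda>z. exp (\<i> * of_real (k z)) :: complex) has_derivative (\<lambda>v. \<i> * of_real (k v))) (at 0)"
      if "bounded_linear k" for k :: "real \<times> real \<Rightarrow> real"
      using has_derivative_compose[of "\<lambda>z. \<i> * of_real (k z)" "\<lambda>v. \<i> * of_real (k v)" 0 UNIV exp "\<lambda>h. h"]
        bounded_linear_imp_has_derivative[OF that] linear_0[OF bounded_linear.linear[OF that]]
      by (simp add: has_derivative_mult_right has_derivative_of_real)
    show ?thesis
      by (intro has_derivative_Pair has_derivative_mult_right exp' bounded_linear_fst bounded_linear_snd)
  qed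
  then obtain E' where E': "(E has_derivative E') (at 0)"
    unfolding E_def case_prod_beta' cis_conv_exp by blast
  \<comment> \<open>On \<open>X\<close> this composite is the identity. The chain rule then gives
    \<open>T'\<close> a left inverse, and an injective linear endomorphism of the plane is
    surjective.\<close>
  have "((\<lambda>z. y (E (T z))) has_derivative (\<lambda>v. y' (E' (T' v)))) (at 0)"
  proof -
    have "E 0 = u\<^sub>0" by (simp add: E_def zero_prod_def)
    then have "((\<lambda>z. y (E z)) has_derivative (\<lambda>v. y' (E' v))) (at (T 0))"
      using has_derivative_compose[OF E', of y y'] d(2) by (simp add: T0)
    from has_derivative_compose[OF T' this] show ?thesis .
  qed
  then have "((\<lambda>z. z) has_derivative (\<lambda>v. y' (E' (T' v)))) (at 0)"
    by (rule has_derivative_transform_within_open[OF _ X(1,2)]) (use \<psi>(1) in \<open>auto simp: T_def E\<close>)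
  then have "(\<lambda>v. y' (E' (T' v))) = (\<lambda>v. v)"
    using has_derivative_unique has_derivative_ident by blast
  then have "inj T'" by (metis injI)
  then have "surj T'"
    using has_derivative_linear[OF T'] linear_injective_imp_surjective by blast
  then show thesis using that[of T T'] T0 T' \<psi>(2) by (auto simp: T_def)
qed

text \<open>A positive real factor does not change the argument. This replaces the angles of the
  Milnor map by imaginary parts of logarithms of \<open>f\<close> and \<open>g\<close>, which have
  complex expansions.\<close>

lemma Im_Ln_normalized_divide:
  assumes "z \<noteq> 0" "w \<noteq> 0"
  shows "Im (Ln ((z / of_real (norm z)) / (w / of_real (norm w)))) = Im (Ln (z / w))"
proof -
  have "(z / of_real (norm z)) / (w / of_real (norm w)) = of_real (norm w / norm z) * (z / w)"
    by (simp add: field_simps)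
  moreover have "Im (Ln (of_real r * u)) = Im (Ln u)" if "r > 0" "u \<noteq> 0" for r u
    using Ln_times_of_real[OF that] that by (simp add: Ln_of_real)
  ultimately show ?thesis using assms by (metis divide_eq_0_iff divide_pos_pos zero_less_norm_iff)
qed

text \<open>Restates the fold in terms of a parametrization \<open>\<psi>\<close> of the source and
  a change \<open>T\<close> of target coordinates from the fold chart to the angles. Of the source
  manifold only the constancy of the norm is retained.\<close>

lemma fold_normal_form:
  fixes f g :: "'n::finite cpoly"
  defines "M \<equiv> \<lambda>\<epsilon>. sphere 0 \<epsilon> - K_link \<epsilon> f g"
  assumes fold: "fold_of_index TYPE('m::finite) (M \<epsilon>) torus (milnor_product f g) p l"
  obtains L :: "'m::finite set" and X :: "((real ^ 'm) \<times> real) set"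
    and \<psi> \<psi>' and T T' :: "real \<times> real \<Rightarrow> real \<times> real"
  where "card L = l" "open X" "0 \<in> X" "\<psi> 0 = p" "(\<psi> has_derivative \<psi>') (at 0)" "inj \<psi>'"
    "T 0 = 0" "(T has_derivative T') (at 0)" "surj T'" "\<And>z. z \<in> X \<Longrightarrow> norm (\<psi> z) = \<epsilon>"
    "\<And>z. z \<in> X \<Longrightarrow> (Im (Ln (poly_eval f (\<psi> z) / poly_eval f p)),
                     Im (Ln (poly_eval g (\<psi> z) / poly_eval g p)))
       = T (snd z, - (\<Sum>i\<in>L. (fst z $ i)\<^sup>2) + (\<Sum>i\<in>-L. (fst z $ i)\<^sup>2))"
proof -
  let ?\<Phi> = "milnor_product f g"
  obtain U V L and x :: "complex ^ 'n \<Rightarrow> (real ^ 'm) \<times> real" and y :: "complex \<times> complex \<Rightarrow> real \<times> real"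
    where xU: "local_coords (M \<epsilon>) p U x" and yV: "local_coords torus (?\<Phi> p) V y"
      and sub: "?\<Phi> ` (U \<inter> M \<epsilon>) \<subseteq> V \<inter> torus" and L: "card L = l"
      and nf: "\<And>q. q \<in> U \<inter> M \<epsilon> \<Longrightarrow> y (?\<Phi> q) = (snd (x q),
           - (\<Sum>i\<in>L. (fst (x q) $ i)\<^sup>2) + (\<Sum>i\<in>-L. (fst (x q) $ i)\<^sup>2))"
    using fold unfolding fold_of_index_def prod_eq_iff fst_conv snd_conv by blast
  obtain X \<psi> \<psi>' x' where X: "open X" "0 \<in> X" "\<psi> 0 = p"
    and \<psi>: "\<And>z. z \<in> X \<Longrightarrow> \<psi> z \<in> U \<inter> M \<epsilon> \<and> x (\<psi> z) = z"
    and d: "(\<psi> has_derivative \<psi>') (at 0)" "\<And>v. x' (\<psi>' v) = v"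
    using local_coords_inverse[OF xU] by metis
  obtain T T' where T: "T 0 = 0" "(T has_derivative T') (at 0)" "surj T'"
    and angles: "\<And>u. u \<in> V \<inter> torus \<Longrightarrow> torus_angles (?\<Phi> p) u = T (y u)"
    using torus_angles_chart[OF yV] by metis
  have nz: "poly_eval f q \<noteq> 0" "poly_eval g q \<noteq> 0" "norm q = \<epsilon>" if "q \<in> M \<epsilon>" for q
    using that by (auto simp: M_def K_link_def)
  have p: "p \<in> M \<epsilon>" using \<psi>[OF X(2)] X(3) by auto
  have angles_eq: "torus_angles (?\<Phi> p) (?\<Phi> q) = (Im (Ln (poly_eval f q / poly_eval f p)),
                     Im (Ln (poly_eval g q / poly_eval g p)))" if "q \<in> M \<epsilon>" for q
    unfolding torus_angles_def milnor_product_def fst_conv snd_conv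
    using nz[OF that] nz[OF p] by (simp only: Im_Ln_normalized_divide not_False_eq_True)
  show thesis
  proof (rule that[of L X \<psi> \<psi>' T T'])
    show "inj \<psi>'" using d(2) by (metis injI)
  next
    fix z assume z: "z \<in> X"
    then show "norm (\<psi> z) = \<epsilon>" using \<psi> nz by blast
    have "\<psi> z \<in> U \<inter> M \<epsilon>" "x (\<psi> z) = z" using \<psi>[OF z] by auto
    then show "(Im (Ln (poly_eval f (\<psi> z) / poly_eval f p)),
                     Im (Ln (poly_eval g (\<psi> z) / poly_eval g p)))
       = T (snd z, - (\<Sum>i\<in>L. (fst z $ i)\<^sup>2) + (\<Sum>i\<in>-L. (fst z $ i)\<^sup>2))"
      using angles[of "?\<Phi> (\<psi> z)"] nf[of "\<psi> z"] sub angles_eq[of "\<psi> z"] by auto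
  qed (fact L X d T)+
qed


section \<open>The index\<close>

text \<open>The kernel of \<open>h\<close> is closed under multiplication by \<open>\<i>\<close>.
  Vanishing of the imaginary part at both \<open>w\<close> and \<open>\<i> *s w\<close> therefore
  forces \<open>D w = 0\<close>, and two complex functionals with nested kernels are
  proportional.\<close>

lemma linear_eq_scaled_hermitian_product:
  fixes p :: "complex ^ 'n::finite" and D :: "complex ^ 'n \<Rightarrow> complex"
  defines "h \<equiv> \<lambda>v. \<Sum>j\<in>UNIV. v $ j * cnj (p $ j)"
  assumes D: "\<And>u v. D (u + v) = D u + D v" "\<And>c v. D (c *s v) = c * D v"
    and "p \<noteq> 0" and ker: "\<And>v. h v = 0 \<Longrightarrow> Im (D v) = 0"
  shows "D v = D p / h p * h v"
proof -
  have h: "h (u + v) = h u + h v" "h (c *s v) = c * h v" for u v c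
    by (simp_all add: h_def algebra_simps sum.distrib sum_distrib_left)
  have "Re (h p) = p \<bullet> p" unfolding h_def by (rule Re_hermitian_product)
  then have nz: "h p \<noteq> 0" using \<open>p \<noteq> 0\<close> by auto
  have ker': "D w = 0" if "h w = 0" for w
  proof -
    have "h (\<i> *s w) = 0" using that by (simp add: h)
    then show ?thesis using ker[OF that] ker[of "\<i> *s w"] by (simp add: D complex_eq_iff)
  qed
  \<comment> \<open>The component of \<open>v\<close> orthogonal to \<open>p\<close>.\<close>
  define w where "w = v + (- (h v / h p)) *s p"
  have "h w = 0" unfolding w_def h using nz by simp
  then have "D w = 0" by (rule ker')
  then show ?thesis unfolding w_def D by simp
qed

text \<open>Here \<open>a\<close> and \<open>b\<close> stand for the logarithms of the normalized
  polynomials, and \<open>e\<close> for the Euler vector, at which both differentials have known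
  values. That \<open>c\<close> is real lets the condition \<open>Im (Da v) = 0\<close> speak about
  the hermitian product with \<open>p\<close>.\<close>

lemma card_eq_of_fold_normal_form:
  fixes a b :: "complex ^ 'n::finite \<Rightarrow> complex" and L :: "'m::finite set"
    and T T' :: "real \<times> real \<Rightarrow> real \<times> real"
  defines "q \<equiv> \<lambda>v. - (\<Sum>i\<in>L. (v $ i)\<^sup>2) + (\<Sum>i\<in>-L. ((v :: real ^ 'm) $ i)\<^sup>2)"
    and "H \<equiv> \<lambda>p v. \<Sum>j\<in>UNIV. v $ j * cnj ((p :: complex ^ 'n) $ j)"
  assumes dim: "CARD('m) = 2 * CARD('n) - 2"
    and a: "quad_jet a p Da Qa" and b: "quad_jet b p Db Qb"
    and ab0: "a p = 0" "b p = 0" and "p \<noteq> 0"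
    and Da: "\<And>v. Da v = of_real c * H p v" "c \<noteq> 0"
    and e: "Da e = 1" "Db e = of_real \<sigma>"
    and X: "open X" "0 \<in> X" and \<psi>: "\<psi> 0 = p" "(\<psi> has_derivative \<psi>') (at 0)" "inj \<psi>'"
    and T: "T 0 = 0" "(T has_derivative T') (at 0)" "surj T'"
    and sph: "\<And>z. z \<in> X \<Longrightarrow> norm (\<psi> z) = \<epsilon>"
    and nf: "\<And>z. z \<in> X \<Longrightarrow> (Im (a (\<psi> z)), Im (b (\<psi> z))) = T (snd z, q (fst z))"
  shows "2 * card L = CARD('m)"
proof -
  have lin\<psi>: "linear \<psi>'" using has_derivative_linear[OF \<psi>(2)] .
  \<comment> \<open>The vectors with last coordinate 0 form the kernel of the differential of the
    fold normal form at 0; \<open>A\<close> carries them to the tangent space at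
    \<open>p\<close>.\<close>
  define A where "A v = \<psi>' (v, 0)" for v
  have linA: "linear A"
    unfolding A_def[abs_def] by (intro linear_compose[OF _ lin\<psi>, unfolded o_def] linearI) auto
  have injA: "inj A" using \<psi>(3) by (auto simp: inj_def A_def)
  have q_scale: "q (t *\<^sub>R v) = t\<^sup>2 * q v" for t v
    by (simp add: q_def power_mult_distrib sum_distrib_left[symmetric] right_diff_distrib)
  have q': "((\<lambda>z. q (fst z)) has_derivative (\<lambda>_. 0)) (at (0 :: (real ^ 'm) \<times> real))"
    unfolding q_def by (auto intro!: derivative_eq_intros bounded_linear.has_derivative[OF bounded_linear_vec_nth])
  have "q 0 = 0" by (simp add: q_def)
  have "((\<lambda>z. (snd z, q (fst z))) has_derivative (\<lambda>v. (snd v, 0)))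
      (at (0 :: (real ^ 'm) \<times> real))"
    by (intro has_derivative_Pair q' has_derivative_snd has_derivative_ident)
  from has_derivative_compose[OF this, of T T']
  have dT: "((\<lambda>z. T (snd z, q (fst z))) has_derivative (\<lambda>v. T' (snd v, 0))) (at 0)"
    using T(2) \<open>q 0 = 0\<close> by (simp add: zero_prod_def)
  have d\<psi>: "((\<lambda>z. k (\<psi> z)) has_derivative (\<lambda>v. D (\<psi>' v))) (at 0)"
    if "quad_jet k p D Q" for k D Q
    using has_derivative_compose[OF \<psi>(2), of k D] quad_jet_has_derivative[OF that] \<psi>(1) by simp
  have "((\<lambda>z. (Im (a (\<psi> z)), Im (b (\<psi> z)))) has_derivative
      (\<lambda>v. (Im (Da (\<psi>' v)), Im (Db (\<psi>' v))))) (at 0)"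
    by (intro has_derivative_Pair has_derivative_Im d\<psi>[OF a] d\<psi>[OF b])
  then have "((\<lambda>z. T (snd z, q (fst z))) has_derivative
      (\<lambda>v. (Im (Da (\<psi>' v)), Im (Db (\<psi>' v))))) (at 0)"
    by (rule has_derivative_transform_within_open[OF _ X]) (rule nf)
  from has_derivative_unique[OF this dT]
  have first: "(Im (Da (\<psi>' v)), Im (Db (\<psi>' v))) = T' (snd v, 0)" for v by (rule fun_cong)
  have T'0: "T' (0, 0) = (0, 0)"
    using linear_0[OF has_derivative_linear[OF T(2)]] by (simp add: zero_prod_def)
  have ImA: "Im (Da (A v)) = 0" "Im (Db (A v)) = 0" for v
    using first[of "(v, 0)"] by (simp_all add: A_def T'0)
  \<comment> \<open>Differentiating the constant squared norm makes the image of
    \<open>\<psi>'\<close> orthogonal to \<open>p\<close> in the real sense. This gives the real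
    part of the hermitian product, while \<open>Da\<close> gives its imaginary part.\<close>
  have "((\<lambda>z. \<psi> z \<bullet> \<psi> z) has_derivative (\<lambda>v. 2 * (p \<bullet> \<psi>' v))) (at 0)"
    using has_derivative_inner[OF \<psi>(2) \<psi>(2)] \<psi>(1) by (simp add: inner_commute)
  then have "((\<lambda>z. \<epsilon>\<^sup>2) has_derivative (\<lambda>v. 2 * (p \<bullet> \<psi>' v))) (at 0)"
    by (rule has_derivative_transform_within_open[OF _ X]) (simp add: dot_square_norm sph)
  from fun_cong[OF has_derivative_unique[OF this has_derivative_const]]
  have "2 * (p \<bullet> \<psi>' v) = 0" for v .
  then have orth: "p \<bullet> \<psi>' v = 0" for v by simp
  have HA: "H p (A v) = 0" for v
  proof -
    have "Re (H p (A v)) = 0"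
      using orth[of "(v, 0)"] Re_hermitian_product(1)[of "A v" p]
      by (simp add: H_def A_def inner_commute)
    moreover have "Im (H p (A v)) = 0" using ImA(1)[of v] Da by simp
    ultimately show ?thesis by (simp add: complex_eq_iff)
  qed
  have "dim (range A) = CARD('m)"
    using dim_image_eq[OF linA, of UNIV] injA by simp
  then have range: "range A = {v. H p v = 0}"
    unfolding H_def using \<open>p \<noteq> 0\<close> dim HA[unfolded H_def]
    by (intro complex_hyperplane_eq linear_subspace_image linA) auto
  have hom: "H p (k *s v) = k * H p v" for k v
    by (simp add: H_def sum_distrib_left mult.assoc)
  have "Im (Db v) = 0" if "H p v = 0" for v
  proof -
    have "v \<in> range A" using that by (simp add: range)
    then show ?thesis using ImA(2) by auto
  qed
  then have Db: "Db v = Db p / H p p * H p v" for v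
    using linear_eq_scaled_hermitian_product[OF quad_jetD(1,2)[OF b] \<open>p \<noteq> 0\<close>] unfolding H_def by blast
  \<comment> \<open>Both functionals are multiples of \<open>H p\<close>, so evaluation at the
    single vector \<open>e\<close> fixes their ratio.\<close>
  have DbDa: "Db v = of_real \<sigma> * Da v" for v
  proof -
    have "c * H p e = 1" using Da e by simp
    then have "Db p / H p p = Db p / H p p * H p e * c" by (simp add: mult.commute mult.left_commute)
    also have "\<dots> = \<sigma> * c" using Db[of e] e(2) by simp
    finally have "Db p / H p p = \<sigma> * c" .
    then show ?thesis using Db[of v] Da by simp
  qed
  have jet: "quad_jet (\<lambda>z. b z + - of_real \<sigma> * a z) p (\<lambda>_. 0) (\<lambda>w. Qb w + - of_real \<sigma> * Qa w)"
    using quad_jet_add[OF b quad_jet_cmult[OF a, of "- of_real \<sigma>"]] by (simp add: DbDa)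
  define Q where "Q w = Qb w + - of_real \<sigma> * Qa w" for w
  \<comment> \<open>\<open>\<eta>\<close> annihilates the image of the differential, i.e. the tangent line of the fold image.\<close>
  define \<eta> where "\<eta> u = snd u - \<sigma> * fst u" for u :: "real \<times> real"
  have \<eta>: "bounded_linear \<eta>"
    unfolding \<eta>_def[abs_def] by (intro bounded_linear_intros)
  \<comment> \<open>The rate at which \<open>\<eta>\<close> changes in the quadratic direction of
    the fold. It is nonzero because \<open>T'\<close> is onto and \<open>\<eta>\<close> already
    vanishes on the image of the other axis.\<close>
  define \<kappa> where "\<kappa> = \<eta> (T' (0, 1))"
  have linT: "linear T'" using has_derivative_linear[OF T(2)] .
  have \<eta>T: "\<eta> (T' (s, 0)) = 0" for s
    using first[of "(0, s)"] by (simp add: \<eta>_def DbDa flip: first[of "(0, s)", simplified])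
  have "\<kappa> \<noteq> 0"
  proof
    assume "\<kappa> = 0"
    obtain z where z: "T' z = (0, 1)" using T(3) by (metis surjD)
    have "z = (fst z, 0) + snd z *\<^sub>R (0, 1)" by (simp add: prod_eq_iff)
    then have "T' z = T' (fst z, 0) + snd z *\<^sub>R T' (0, 1)"
      by (metis linear_add[OF linT] linear_cmul[OF linT])
    then have "\<eta> (T' z) = \<eta> (T' (fst z, 0)) + snd z * \<kappa>"
      by (simp add: \<kappa>_def \<eta>_def algebra_simps)
    then show False using z \<open>\<kappa> = 0\<close> by (simp add: \<eta>T) (simp add: \<eta>_def)
  qed
  have second: "Im (Q (A v)) = \<kappa> * q v" for v
  proof (rule LIM_unique)
    \<comment> \<open>Along this curve the normal form reads \<open>T (0, t\<^sup>2 * q v)\<close>,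
      so the first derivative of \<open>T\<close> governs the second order behaviour in
      \<open>t\<close>. Both sides of the claim are then limits of the same quotient.\<close>
    define \<gamma> where "\<gamma> t = \<psi> (t *\<^sub>R v, 0)" for t
    define \<rho> where "\<rho> r = \<eta> (T (0, r * q v))" for r
    have line: "((\<lambda>t. (t *\<^sub>R v, 0 :: real)) has_derivative (\<lambda>t. (t *\<^sub>R v, 0))) (at 0)"
      by (auto intro!: derivative_eq_intros)
    have "(\<gamma> has_vector_derivative A v) (at 0)"
    proof -
      have "\<psi>' (t *\<^sub>R v, 0) = t *\<^sub>R A v" for t
        using linear_cmul[OF lin\<psi>, of t "(v, 0)"] by (simp add: A_def)
      then show ?thesis
        using has_derivative_compose[OF line, of \<psi> \<psi>'] \<psi>(2)
        by (simp add: has_vector_derivative_def \<gamma>_def[abs_def] zero_prod_def)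
    qed
    moreover have "\<gamma> 0 = p" using \<psi>(1) by (simp add: \<gamma>_def zero_prod_def)
    ultimately have "((\<lambda>t. (b (\<gamma> t) + - of_real \<sigma> * a (\<gamma> t)) / of_real (t\<^sup>2)) \<longlongrightarrow> Q (A v)) (at 0)"
      using quad_jet_limit_along_curve[OF jet] ab0 by (simp add: Q_def)
    then show "((\<lambda>t. Im ((b (\<gamma> t) + - of_real \<sigma> * a (\<gamma> t)) / of_real (t\<^sup>2))) \<longlongrightarrow> Im (Q (A v))) (at 0)"
      by (rule tendsto_Im)
    have "((\<lambda>r. (0, r * q v)) has_derivative (\<lambda>r. (0 :: real, r * q v))) (at 0)"
      by (auto intro!: derivative_eq_intros)
    from has_derivative_compose[OF this, of T T']
    have "((\<lambda>r. T (0, r * q v)) has_derivative (\<lambda>r. T' (0, r * q v))) (at 0)"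
      using T(2) by (simp add: zero_prod_def)
    from bounded_linear.has_derivative[OF \<eta> this]
    have "(\<rho> has_derivative (\<lambda>r. \<eta> (T' (0, r * q v)))) (at 0)"
      by (simp add: \<rho>_def[abs_def])
    moreover have "\<eta> (T' (0, r * q v)) = \<kappa> * q v * r" for r
      using linear_cmul[OF linT, of "r * q v" "(0, 1)"] by (simp add: \<kappa>_def \<eta>_def algebra_simps)
    ultimately have "(\<rho> has_real_derivative \<kappa> * q v) (at 0)"
      by (simp add: has_field_derivative_def)
    then have "((\<lambda>r. \<rho> r / r) \<longlongrightarrow> \<kappa> * q v) (at 0)"
      using T(1) by (simp add: has_field_derivative_iff \<rho>_def \<eta>_def zero_prod_def)
    moreover have "filterlim (\<lambda>t :: real. t\<^sup>2) (at 0) (at 0)"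
      by (rule filterlim_atI) (auto intro!: tendsto_eq_intros simp: eventually_at_filter)
    ultimately have "((\<lambda>t. \<rho> (t\<^sup>2) / t\<^sup>2) \<longlongrightarrow> \<kappa> * q v) (at 0)"
      by (rule filterlim_compose)
    moreover have "\<forall>\<^sub>F t in at 0. \<rho> (t\<^sup>2) / t\<^sup>2
        = Im ((b (\<gamma> t) + - of_real \<sigma> * a (\<gamma> t)) / of_real (t\<^sup>2))"
    proof -
      have "((\<lambda>t. (t *\<^sub>R v, 0 :: real)) \<longlongrightarrow> 0) (at 0)"
        by (auto intro!: tendsto_eq_intros simp: zero_prod_def)
      then have "\<forall>\<^sub>F t in at 0. (t *\<^sub>R v, 0) \<in> X" using X by (rule topological_tendstoD)
      then show ?thesis
      proof eventually_elim
        case (elim t)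
        from nf[OF elim] have "T (0, t\<^sup>2 * q v) = (Im (a (\<gamma> t)), Im (b (\<gamma> t)))"
          by (simp add: q_scale \<gamma>_def)
        then show ?case by (simp add: \<rho>_def \<eta>_def Im_divide_of_real del: of_real_power)
      qed
    qed
    ultimately show "((\<lambda>t. Im ((b (\<gamma> t) + - of_real \<sigma> * a (\<gamma> t)) / of_real (t\<^sup>2))) \<longlongrightarrow> \<kappa> * q v) (at 0)"
      by (rule Lim_transform_eventually)
  qed
  show ?thesis
  proof (rule card_eq_of_complex_quadratic_form[OF linA injA])
    show "Im (Q (A v)) = \<kappa> * (- (\<Sum>i\<in>L. (v $ i)\<^sup>2) + (\<Sum>i\<in>-L. (v $ i)\<^sup>2))" for v
      using second[of v] by (simp only: q_def)
    show "\<i> *s v \<in> range A" if "v \<in> range A" for v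
      using that by (simp add: range hom)
    show "Q (\<i> *s v) = - Q v" for v
      by (simp add: Q_def quad_jetD(4)[OF a] quad_jetD(4)[OF b])
  qed fact
qed

section \<open>Consequences of the Euler equation\<close>

lemma of_rat_in_Reals: "(of_rat r :: complex) \<in> \<real>"
  by (induction r) (simp add: of_rat_rat)

text \<open>The Euler equation at \<open>p\<close> prescribes the value of the linear part at the
  vector with entries \<open>p $ j / of_rat (w $ j)\<close>.\<close>

lemma weighted_homogeneous_jet:
  assumes "weighted_homogeneous w P" "quad_jet (poly_eval P) p D Q"
  shows "D (\<chi> j. p $ j / of_rat (w $ j)) = poly_eval P p"
  using assms by (simp add: quad_jet_linear_part[OF assms(2)] weighted_homogeneous_def)

text \<open>Dependence makes the logarithmic differential a complex multiple \<open>k\<close> of the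
  hermitian product with \<open>p\<close>. At the Euler vector the differential is 1 and the product
  is real because the weights are, so \<open>k\<close> is real and nonzero.\<close>

lemma grad_log_dependent:
  fixes f :: "'n::finite cpoly"
  assumes dep: "lin_dependent_pair p (\<i> *s grad_log (poly_eval f) p)"
    and "p \<noteq> 0" and nz: "poly_eval f p \<noteq> 0"
    and wh: "weighted_homogeneous w f" and jet: "quad_jet (poly_eval f) p D Q"
  obtains c where "c \<noteq> 0" "\<And>v. D v / poly_eval f p = of_real c * (\<Sum>j\<in>UNIV. v $ j * cnj (p $ j))"
proof -
  obtain a b where ab: "(a, b) \<noteq> (0, 0)" "a *s p + b *s (\<i> *s grad_log (poly_eval f) p) = 0"
    using dep by (auto simp: lin_dependent_pair_def)
  have "b \<noteq> 0" using ab \<open>p \<noteq> 0\<close> by (auto simp: vector_mul_eq_0)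
  \<comment> \<open>The conjugate appears because \<open>grad_log\<close> conjugates the partial
    derivatives.\<close>
  define k where "k = cnj (\<i> * a / b)"
  have "grad_log (poly_eval f) p $ j = cnj k * p $ j" for j
  proof -
    have "a * p $ j + b * (\<i> * grad_log (poly_eval f) p $ j) = 0"
      using arg_cong[OF ab(2), of "\<lambda>v. v $ j"] by (simp add: mult.assoc)
    then have "\<i> * (a * p $ j) = b * grad_log (poly_eval f) p $ j"
      by (simp add: complex_eq_iff algebra_simps)
    then show ?thesis using \<open>b \<noteq> 0\<close> by (simp add: k_def field_simps)
  qed
  from arg_cong[OF this, of cnj]
  have "cpartial j (poly_eval f) p / poly_eval f p = k * cnj (p $ j)" for j
    by (simp add: grad_log_def)
  then have D: "D v / poly_eval f p = k * (\<Sum>j\<in>UNIV. v $ j * cnj (p $ j))" for v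
    unfolding quad_jet_linear_part[OF jet] sum_divide_distrib sum_distrib_left
    by (intro sum.cong) (simp_all add: mult.left_commute flip: times_divide_eq_right)
  define e :: "complex ^ 'n" where "e = (\<chi> j. p $ j / of_rat (w $ j))"
  define H where "H = (\<Sum>j\<in>UNIV. e $ j * cnj (p $ j))"
  have "k * H = 1"
    using D[of e] weighted_homogeneous_jet[OF wh jet] nz by (simp add: e_def H_def)
  have "H \<in> \<real>"
    unfolding H_def
  proof (rule sum_in_Reals)
    fix j
    have "e $ j * cnj (p $ j) = (p $ j * cnj (p $ j)) / of_rat (w $ j)" by (simp add: e_def)
    also have "\<dots> \<in> \<real>"
      by (intro Reals_divide of_rat_in_Reals) (simp add: complex_mult_cnj)
    finally show "e $ j * cnj (p $ j) \<in> \<real>" .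
  qed
  then have "k \<in> \<real>"
    using \<open>k * H = 1\<close> by (metis Reals_inverse inverse_unique mult.commute)
  then obtain c where "k = of_real c" by (auto elim: Reals_cases)
  moreover have "k \<noteq> 0" using \<open>k * H = 1\<close> by auto
  ultimately show thesis using that[of c] D by simp
qed

lemma fold_index_eq:
  fixes f g :: "'n::finite cpoly" and wf wg :: "rat ^ 'n" and s :: rat
  assumes dim: "CARD('m::finite) = 2 * CARD('n) - 2"
    and wf: "weighted_homogeneous wf f" and wg: "weighted_homogeneous wg g"
    and s: "s > 0" "wg = s *s wf" and "\<epsilon> > 0"
    and p: "p \<in> sphere 0 \<epsilon> - K_link \<epsilon> f g"
    and dep: "lin_dependent_pair p (\<i> *s grad_log (poly_eval f) p)"
    and fold: "fold_of_index TYPE('m) (sphere 0 \<epsilon> - K_link \<epsilon> f g) torus (milnor_product f g) p l"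
  shows "l = CARD('n) - 1"
proof -
  have "p \<noteq> 0" and nz: "poly_eval f p \<noteq> 0" "poly_eval g p \<noteq> 0"
    using p \<open>\<epsilon> > 0\<close> by (auto simp: K_link_def)
  obtain Df Qf Dg Qg where jf: "quad_jet (poly_eval f) p Df Qf" and jg: "quad_jet (poly_eval g) p Dg Qg"
    using quad_jet_poly_eval by metis
  obtain c where c: "c \<noteq> 0" "\<And>v. Df v / poly_eval f p = of_real c * (\<Sum>j\<in>UNIV. v $ j * cnj (p $ j))"
    using grad_log_dependent[OF dep \<open>p \<noteq> 0\<close> nz(1) wf jf] by metis
  define e :: "complex ^ 'n" where "e = (\<chi> j. p $ j / of_rat (wf $ j))"
  have "Df e = poly_eval f p"
    using weighted_homogeneous_jet[OF wf jf] by (simp add: e_def)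
  then have ef: "Df e / poly_eval f p = 1" using nz by simp
  \<comment> \<open>The Euler vector of \<open>f\<close> is \<open>s\<close> times that of
    \<open>g\<close>, so the logarithmic differential of \<open>g\<close> takes the value
    \<open>s\<close> where that of \<open>f\<close> takes the value 1.\<close>
  have "e = of_rat s *s (\<chi> j. p $ j / of_rat (wg $ j))"
    using s by (simp add: e_def vec_eq_iff of_rat_mult)
  then have "Dg e = of_rat s * poly_eval g p"
    using weighted_homogeneous_jet[OF wg jg] by (simp add: quad_jetD(2)[OF jg])
  moreover obtain \<sigma> where "(of_rat s :: complex) = of_real \<sigma>"
    using of_rat_in_Reals by (auto elim: Reals_cases)
  ultimately have eg: "Dg e / poly_eval g p = of_real \<sigma>" using nz by simp
  show ?thesis
  proof (rule fold_normal_form[OF fold])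
    fix L :: "'m set" and X \<psi> \<psi>' and T T' :: "real \<times> real \<Rightarrow> real \<times> real"
    assume "card L = l" and nf: "open X" "0 \<in> X" "\<psi> 0 = p" "(\<psi> has_derivative \<psi>') (at 0)" "inj \<psi>'"
      "T 0 = 0" "(T has_derivative T') (at 0)" "surj T'" "\<And>z. z \<in> X \<Longrightarrow> norm (\<psi> z) = \<epsilon>"
      "\<And>z. z \<in> X \<Longrightarrow> (Im (Ln (poly_eval f (\<psi> z) / poly_eval f p)),
                       Im (Ln (poly_eval g (\<psi> z) / poly_eval g p)))
         = T (snd z, - (\<Sum>i\<in>L. (fst z $ i)\<^sup>2) + (\<Sum>i\<in>-L. (fst z $ i)\<^sup>2))"
    note jets = quad_jet_Ln[OF jf nz(1)] quad_jet_Ln[OF jg nz(2)]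
    have "2 * card L = CARD('m)"
      by (rule card_eq_of_fold_normal_form[OF dim jets _ _ \<open>p \<noteq> 0\<close> c(2,1) ef eg nf])
         (simp_all add: nz)
    then show ?thesis using dim \<open>card L = l\<close> by simp
  qed
qed

theorem proposition3p9:
  fixes f g :: "'n::finite cpoly"
    and wf wg :: "rat ^ 'n"
    and s :: rat
  assumes "CARD('n) \<ge> 2"
    and "CARD('m::finite) = 2 * CARD('n) - 2"
    and "weighted_homogeneous wf f"
    and "weighted_homogeneous wg g"
    and "s > 0"
    and "wg = s *s wf"
  shows "\<exists>\<epsilon>0 > 0. \<forall>\<epsilon>. 0 < \<epsilon> \<and> \<epsilon> \<le> \<epsilon>0 \<longrightarrow>
    (\<forall>p \<in> sphere 0 \<epsilon> - K_link \<epsilon> f g.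
       fold_point TYPE('m) (sphere 0 \<epsilon> - K_link \<epsilon> f g) torus (milnor_product f g) p \<longrightarrow>
       lin_dependent_pair p (\<i> *s grad_log (poly_eval f) p) \<longrightarrow>
       (\<forall>l. fold_of_index TYPE('m) (sphere 0 \<epsilon> - K_link \<epsilon> f g) torus (milnor_product f g) p l
            \<longleftrightarrow> l = CARD('n) - 1))"
proof (intro exI[of _ 1] conjI allI ballI impI)
  \<comment> \<open>The witness 1 is an arbitrary choice, as \<open>fold_index_eq\<close> applies to
    every positive radius.\<close>
  fix \<epsilon> :: real and p l
  assume "0 < \<epsilon> \<and> \<epsilon> \<le> 1" and p: "p \<in> sphere 0 \<epsilon> - K_link \<epsilon> f g"
    and fp: "fold_point TYPE('m) (sphere 0 \<epsilon> - K_link \<epsilon> f g) torus (milnor_product f g) p"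
    and dep: "lin_dependent_pair p (\<i> *s grad_log (poly_eval f) p)"
  then have index: "l' = CARD('n) - 1"
    if "fold_of_index TYPE('m) (sphere 0 \<epsilon> - K_link \<epsilon> f g) torus (milnor_product f g) p l'" for l'
    using fold_index_eq[OF assms(2-6) _ p dep that] by simp
  \<comment> \<open>For the implication from right to left, \<open>fp\<close> provides some index,
    and \<open>index\<close> identifies it as n - 1.\<close>
  then show "fold_of_index TYPE('m) (sphere 0 \<epsilon> - K_link \<epsilon> f g) torus (milnor_product f g) p l
      \<longleftrightarrow> l = CARD('n) - 1"
    using fp unfolding fold_point_def by metis
qed simp

end
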